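(* For all integers $n\ge 1$ and $0\le k\le n^2$, the Mahonian number of type $B$ counts the integer partitions with exactly $k$ parts, with largest part at most $n$, in which each part $j$ is repeated at most $2j-1$ times; that is, $$i_B(n,k)=|\mathcal{P}r_{n,k}|.$$
   Context: $B_n$ is the hyperoctahedral group: the group of bijections $\pi$ of $\{-n,\ldots,-1,1,\ldots,n\}$ with $\pi(-j)=-\pi(j)$ for all $j\in\{1,\dots,n\}$. Every $\pi\in B_n$ is written uniquely as $\pi(p)=(-1)^{r_p}\sigma_p$ for $1\le p\le n$, with $r_p\in\{0,1\}$ and $\sigma=\sigma_1\cdots\sigma_n$ a permutation of $\{1,\dots,n\}$. For $1\le i\le n$ put $m=n+1-i$ and $inv_i(\sigma)=|\{j: j<m,\ \sigma_j>\sigma_m\}|$, and define $inv_i(\pi)=inv_i(\sigma)$ if $r_m=0$, and $inv_i(\pi)=1+2|\{j: j<m,\ \sigma_j<\sigma_m\}|+inv_i(\sigma)$ if $r_m=1$. The number of inversions of type $B$ of $\pi$ is $inv_B(\pi)=\sum_{i=1}^n inv_i(\pi)$. The Mahonian number of type $B$ is $i_B(n,k)=|\{\pi\in B_n: inv_B(\pi)=k\}|$. $\mathcal{P}r_{n,k}$ is the set of integer partitions $\lambda=(\lambda_1\ge\lambda_2\ge\cdots\ge\lambda_k\ge 1)$ into exactly $k$ parts, with largest part less than or equal to $n$, such that each part $j$ occurs at most $2j-1$ times. For $k=0$ the only partition is the empty one. *)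

theory Defs
  imports "HOL-Combinatorics.Permutations"
begin

(* A signed permutation is represented as a function on all of int; permutes makes it
   the identity outside of {-n,...,-1,1,...,n}, so each bijection is represented exactly once. *)
definition hyperoctahedral :: "nat \<Rightarrow> (int \<Rightarrow> int) set" where
  "hyperoctahedral n =
     {\<pi>. \<pi> permutes ({- int n..int n} - {0}) \<and> (\<forall>j\<in>{1..int n}. \<pi> (- j) = - \<pi> j)}"

(* The unique decomposition \<pi>(p) = (-1)^(r_p) * \<sigma>_p; see the lemmas below. *)
definition sign_exp :: "(int \<Rightarrow> int) \<Rightarrow> nat \<Rightarrow> nat" where
  "sign_exp \<pi> p = (if \<pi> (int p) < 0 then 1 else 0)"

definition underlying :: "(int \<Rightarrow> int) \<Rightarrow> nat \<Rightarrow> nat" where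
  "underlying \<pi> p = nat \<bar>\<pi> (int p)\<bar>"

definition inv_A :: "nat \<Rightarrow> nat \<Rightarrow> (nat \<Rightarrow> nat) \<Rightarrow> nat" where
  "inv_A n i \<sigma> = (let m = n + 1 - i in card {j \<in> {1..<m}. \<sigma> j > \<sigma> m})"

definition inv_B_at :: "nat \<Rightarrow> nat \<Rightarrow> (int \<Rightarrow> int) \<Rightarrow> nat" where
  "inv_B_at n i \<pi> =
     (let m = n + 1 - i; \<sigma> = underlying \<pi>
      in if sign_exp \<pi> m = 0 then inv_A n i \<sigma>
         else 1 + 2 * card {j \<in> {1..<m}. \<sigma> j < \<sigma> m} + inv_A n i \<sigma>)"

definition inv_B :: "nat \<Rightarrow> (int \<Rightarrow> int) \<Rightarrow> nat" where
  "inv_B n \<pi> = (\<Sum>i=1..n. inv_B_at n i \<pi>)"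

definition mahonian_B :: "nat \<Rightarrow> nat \<Rightarrow> nat" where
  "mahonian_B n k = card {\<pi> \<in> hyperoctahedral n. inv_B n \<pi> = k}"

definition restricted_partitions :: "nat \<Rightarrow> nat \<Rightarrow> nat list set" where
  "restricted_partitions n k =
     {ps. sorted_wrt (\<ge>) ps \<and> length ps = k \<and> (\<forall>p\<in>set ps. 1 \<le> p \<and> p \<le> n) \<and>
          (\<forall>j\<in>{1..n}. count_list ps j \<le> 2 * j - 1)}"

lemma hyperoctahedral_in_range:
  assumes "\<pi> \<in> hyperoctahedral n" and "p \<in> {1..n}"
  shows "\<pi> (int p) \<in> {- int n..int n} - {0}"
proof -
  have "\<pi> permutes ({- int n..int n} - {0})"
    using assms(1) by (simp add: hyperoctahedral_def)
  moreover have "int p \<in> {- int n..int n} - {0}"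
    using assms(2) by auto
  ultimately show ?thesis
    by (simp only: permutes_in_image)
qed

lemma signed_decomposition:
  "\<pi> (int p) = (-1) ^ sign_exp \<pi> p * int (underlying \<pi> p)"
  by (simp add: sign_exp_def underlying_def)

lemma underlying_permutation:
  assumes "\<pi> \<in> hyperoctahedral n"
  shows "bij_betw (underlying \<pi>) {1..n} {1..n}"
proof -
  have perm: "\<pi> permutes ({- int n..int n} - {0})"
    and neg: "\<And>j. j \<in> {1..int n} \<Longrightarrow> \<pi> (- j) = - \<pi> j"
    using assms by (auto simp: hyperoctahedral_def)
  have inj: "\<pi> x = \<pi> y \<Longrightarrow> x = y" for x y
    using permutes_inj[OF perm] by (auto dest: injD)
  have "inj_on (underlying \<pi>) {1..n}"
  proof (rule inj_onI)
    fix p q assume p: "p \<in> {1..n}" and q: "q \<in> {1..n}" and "underlying \<pi> p = underlying \<pi> q"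
    then have "\<pi> (int p) = \<pi> (int q) \<or> \<pi> (int p) = - \<pi> (int q)"
      by (auto simp: underlying_def abs_if split: if_splits)
    then have "\<pi> (int p) = \<pi> (int q) \<or> \<pi> (int p) = \<pi> (- int q)"
      using neg[of "int q"] q by auto
    then have "int p = int q \<or> int p = - int q"
      using inj by blast
    then show "p = q" using p q by auto
  qed
  moreover have "underlying \<pi> ` {1..n} \<subseteq> {1..n}"
  proof
    fix y assume "y \<in> underlying \<pi> ` {1..n}"
    then obtain p where "p \<in> {1..n}" "y = underlying \<pi> p" by blast
    with hyperoctahedral_in_range[OF assms, of p] show "y \<in> {1..n}"
      by (auto simp: underlying_def)
  qed
  ultimately show ?thesis
    by (simp add: bij_betw_def endo_inj_surj)
qed

lemma signed_decomposition_unique: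
  assumes "\<pi> (int p) = (-1) ^ r * int s" and "r \<in> {0, 1}" and "1 \<le> s"
  shows "r = sign_exp \<pi> p \<and> s = underlying \<pi> p"
  using assms by (auto simp: sign_exp_def underlying_def)

end

theory Submission
  imports Defs "HOL-Library.Multiset" "HOL-Library.FuncSet"
begin

text \<open>
  Both sides count the same bounded vectors: the functions \<open>f\<close> on \<open>{1..n}\<close> with
  \<open>0 \<le> f m < 2 * m\<close> and total \<open>k\<close>.

  For a partition, \<open>f j\<close> is the multiplicity of the part \<open>j\<close>; the total of the multiplicities is the
  number of parts (\<open>bij_betw_multiplicities\<close>).

  For a signed permutation, \<open>f m\<close> is the contribution of position \<open>m\<close> to the number of inversions.
  Let \<open>g\<close> and \<open>l\<close> count the positions \<open>j < m\<close> whose absolute value is greater,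
  respectively smaller, than the one at \<open>m\<close>, so that \<open>g + l = m - 1\<close>. Position \<open>m\<close> contributes \<open>g\<close>
  if its sign is positive, and \<open>1 + 2 * l + g = m + l\<close> if it is negative. The first value ranges over
  \<open>0, ..., m - 1\<close> and the second over \<open>m, ..., 2 * m - 1\<close>, so the contribution determines both the sign
  and \<open>g\<close>, that is, the signed permutation can be read off its vector as from a Lehmer code
  (\<open>inj_on_inv_table\<close>). There are \<open>\<Prod>m=1..n. 2 * m = 2 ^ n * n!\<close> bounded vectors and at least as
  many signed permutations (\<open>card_hyperoctahedral_ge\<close>), so the injection is a bijection.
\<close>

section \<open>Signed permutations and their inversion tables\<close>

definition num_greater :: "(nat \<Rightarrow> nat) \<Rightarrow> nat \<Rightarrow> nat" where
  "num_greater \<sigma> m = card {j \<in> {1..<m}. \<sigma> j > \<sigma> m}"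

definition num_less :: "(nat \<Rightarrow> nat) \<Rightarrow> nat \<Rightarrow> nat" where
  "num_less \<sigma> m = card {j \<in> {1..<m}. \<sigma> j < \<sigma> m}"

text \<open>The contribution of position \<open>m\<close> to the number of inversions. Indexing by the position itself,
  and not by its distance from the right end, makes the bound \<open>2 * m\<close> match the bound on the
  multiplicity of the part \<open>m\<close>.\<close>

definition inv_table_at :: "(int \<Rightarrow> int) \<Rightarrow> nat \<Rightarrow> nat" where
  "inv_table_at \<pi> m =
     (if sign_exp \<pi> m = 0 then num_greater (underlying \<pi>) m
      else 1 + 2 * num_less (underlying \<pi>) m + num_greater (underlying \<pi>) m)"

definition inv_table :: "nat \<Rightarrow> (int \<Rightarrow> int) \<Rightarrow> nat \<Rightarrow> nat" where
  "inv_table n \<pi> = restrict (inv_table_at \<pi>) {1..n}"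

definition bounded_vectors :: "nat \<Rightarrow> (nat \<Rightarrow> nat) set" where
  "bounded_vectors n = (\<Pi>\<^sub>E m\<in>{1..n}. {..<2 * m})"

lemma inv_B_eq_sum_inv_table: "inv_B n \<pi> = (\<Sum>m=1..n. inv_table n \<pi> m)"
proof -
  have "inv_B n \<pi> = (\<Sum>i=1..n. inv_table_at \<pi> (n + 1 - i))"
    unfolding inv_B_def
    by (rule sum.cong)
      (simp_all add: inv_B_at_def inv_table_at_def inv_A_def num_greater_def num_less_def Let_def)
  also have "\<dots> = (\<Sum>m=1..n. inv_table_at \<pi> m)"
    by (subst sum.atLeastAtMost_rev) (simp add: add.commute)
  finally show ?thesis by (simp add: inv_table_def)
qed

lemma num_less_plus_num_greater:
  assumes "inj_on \<sigma> {1..n}" "m \<in> {1..n}"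
  shows "num_less \<sigma> m + num_greater \<sigma> m = m - 1"
proof -
  have "\<sigma> j \<noteq> \<sigma> m" if "j \<in> {1..<m}" for j
    using assms that by (auto dest: inj_onD)
  then have "{j \<in> {1..<m}. \<sigma> j < \<sigma> m} \<union> {j \<in> {1..<m}. \<sigma> j > \<sigma> m} = {1..<m}"
    by (force simp: neq_iff)
  moreover have "card ({j \<in> {1..<m}. \<sigma> j < \<sigma> m} \<union> {j \<in> {1..<m}. \<sigma> j > \<sigma> m}) =
      num_less \<sigma> m + num_greater \<sigma> m"
    unfolding num_less_def num_greater_def by (rule card_Un_disjoint) auto
  ultimately show ?thesis by simp
qed

lemma inv_table_in_bounded_vectors:
  assumes "\<pi> \<in> hyperoctahedral n"
  shows "inv_table n \<pi> \<in> bounded_vectors n"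
proof -
  have "inj_on (underlying \<pi>) {1..n}"
    using underlying_permutation[OF assms] by (rule bij_betw_imp_inj_on)
  from num_less_plus_num_greater[OF this] show ?thesis
    by (fastforce simp: inv_table_def bounded_vectors_def inv_table_at_def)
qed

text \<open>The two ranges \<open>{0..<m}\<close> and \<open>{m..<2 * m}\<close> of the contribution at \<open>m\<close> tell the signs apart; in the
  second range the excess over \<open>m\<close> is the number of smaller entries, which determines the number of
  greater ones.\<close>

lemma inv_table_at_eqD:
  assumes "\<pi> \<in> hyperoctahedral n" "\<rho> \<in> hyperoctahedral n" "m \<in> {1..n}"
    and eq: "inv_table_at \<pi> m = inv_table_at \<rho> m"
  shows "sign_exp \<pi> m = sign_exp \<rho> m"
    and "num_greater (underlying \<pi>) m = num_greater (underlying \<rho>) m"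
proof -
  have "num_less (underlying \<tau>) m + num_greater (underlying \<tau>) m = m - 1"
    if "\<tau> \<in> hyperoctahedral n" for \<tau>
    using num_less_plus_num_greater bij_betw_imp_inj_on underlying_permutation that assms(3)
    by blast
  from this[OF assms(1)] this[OF assms(2)] eq assms(3)
  have "sign_exp \<pi> m = sign_exp \<rho> m \<and>
    num_greater (underlying \<pi>) m = num_greater (underlying \<rho>) m"
    by (auto simp: inv_table_at_def sign_exp_def split: if_splits)
  then show "sign_exp \<pi> m = sign_exp \<rho> m"
    and "num_greater (underlying \<pi>) m = num_greater (underlying \<rho>) m" by auto
qed

lemma card_greater_inj:
  fixes S :: "'a::linorder set"
  assumes "finite S" "a \<in> S" "b \<in> S" "card {x \<in> S. x > a} = card {x \<in> S. x > b}"
  shows "a = b"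
proof -
  have "card {x \<in> S. x > d} < card {x \<in> S. x > c}" if "c < d" "d \<in> S" for c d
    using assms(1) that by (intro psubset_card_mono) auto
  from this[of a b] this[of b a] assms show ?thesis by (cases a b rule: linorder_cases) auto
qed

lemma num_greater_eq_card_image:
  assumes "inj_on \<sigma> {1..n}" "m \<in> {1..n}"
  shows "num_greater \<sigma> m = card {x \<in> \<sigma> ` {1..m}. x > \<sigma> m}"
proof -
  have "{x \<in> \<sigma> ` {1..m}. x > \<sigma> m} = \<sigma> ` {j \<in> {1..<m}. \<sigma> j > \<sigma> m}"
    using le_neq_implies_less by fastforce
  moreover have "inj_on \<sigma> {j \<in> {1..<m}. \<sigma> j > \<sigma> m}"
    by (rule inj_on_subset[OF assms(1)]) (use assms(2) in auto)
  ultimately show ?thesis by (simp add: num_greater_def card_image)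
qed

text \<open>A permutation is decoded from right to left: once the entries to the right of \<open>m\<close> are known, so is
  the set of the remaining ones, and the entry at \<open>m\<close> is the element of that set with the prescribed
  number of greater elements.\<close>

lemma lehmer_code_inj:
  assumes \<sigma>: "bij_betw \<sigma> {1..n} {1..n}" and \<tau>: "bij_betw \<tau> {1..n} {1..n}"
    and eq: "\<And>m. m \<in> {1..n} \<Longrightarrow> num_greater \<sigma> m = num_greater \<tau> m"
    and "m \<in> {1..n}"
  shows "\<sigma> m = \<tau> m"
  using \<open>m \<in> {1..n}\<close>
proof (induction "n - m" arbitrary: m rule: less_induct)
  case less
  have remaining: "f ` {1..m} = {1..n} - f ` {m<..n}" if "bij_betw f {1..n} {1..n}" for f
  proof -
    have "{1..m} = {1..n} - {m<..n}" using less.prems by auto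
    also have "f ` \<dots> = f ` {1..n} - f ` {m<..n}"
      using that by (intro inj_on_image_set_diff[of f "{1..n}"]) (auto simp: bij_betw_def)
    also have "f ` {1..n} = {1..n}"
      using that by (simp add: bij_betw_def)
    finally show ?thesis .
  qed
  have "\<sigma> ` {m<..n} = \<tau> ` {m<..n}"
    by (rule image_cong) (use less in auto)
  then have S: "\<sigma> ` {1..m} = \<tau> ` {1..m}"
    using remaining[OF \<sigma>] remaining[OF \<tau>] by simp
  show ?case
  proof (rule card_greater_inj[of "\<sigma> ` {1..m}"])
    show "\<tau> m \<in> \<sigma> ` {1..m}" unfolding S using less.prems by auto
    show "card {x \<in> \<sigma> ` {1..m}. x > \<sigma> m} = card {x \<in> \<sigma> ` {1..m}. x > \<tau> m}"
      using eq[OF less.prems] num_greater_eq_card_image[OF _ less.prems] \<sigma> \<tau> S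
      by (simp add: bij_betw_def)
  qed (use less.prems in auto)
qed

lemma hyperoctahedral_eqI:
  assumes \<pi>: "\<pi> \<in> hyperoctahedral n" and \<rho>: "\<rho> \<in> hyperoctahedral n"
    and eq: "\<And>p. p \<in> {1..n} \<Longrightarrow> \<pi> (int p) = \<rho> (int p)"
  shows "\<pi> = \<rho>"
proof
  fix x
  have pos: "\<pi> y = \<rho> y" if "y \<in> {1..int n}" for y
    using eq[of "nat y"] that by (simp add: nat_le_iff le_nat_iff)
  consider "x \<in> {1..int n}" | "- x \<in> {1..int n}" | "x \<notin> {- int n..int n} - {0}"
    by fastforce
  then show "\<pi> x = \<rho> x"
  proof cases
    case 2
    then have "\<pi> (- (- x)) = - \<pi> (- x)" "\<rho> (- (- x)) = - \<rho> (- x)"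
      using \<pi> \<rho> unfolding hyperoctahedral_def by blast+
    with pos[OF 2] show ?thesis by simp
  next
    case 3
    with \<pi> \<rho> show ?thesis
      unfolding hyperoctahedral_def by (auto simp del: Diff_iff dest!: permutes_not_in)
  qed (rule pos)
qed

lemma inj_on_inv_table: "inj_on (inv_table n) (hyperoctahedral n)"
proof (rule inj_onI)
  fix \<pi> \<rho>
  assume \<pi>: "\<pi> \<in> hyperoctahedral n" and \<rho>: "\<rho> \<in> hyperoctahedral n"
    and eq: "inv_table n \<pi> = inv_table n \<rho>"
  have at: "inv_table_at \<pi> m = inv_table_at \<rho> m" if "m \<in> {1..n}" for m
    using fun_cong[OF eq, of m] that by (simp add: inv_table_def)
  have "sign_exp \<pi> p = sign_exp \<rho> p" "underlying \<pi> p = underlying \<rho> p" if "p \<in> {1..n}" for p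
    using inv_table_at_eqD[OF \<pi> \<rho> _ at] that
      lehmer_code_inj[OF underlying_permutation[OF \<pi>] underlying_permutation[OF \<rho>]]
    by auto
  then show "\<pi> = \<rho>"
    by (intro hyperoctahedral_eqI[OF \<pi> \<rho>]) (metis signed_decomposition)
qed

text \<open>For \<open>\<sigma>\<close> a permutation of \<open>{1..n}\<close>: the signed permutation with absolute values \<open>\<sigma>\<close> and
  negative signs at the positions in \<open>N\<close>. These pairs supply the \<open>2 ^ n * n!\<close> signed permutations
  that turn the injectivity of the inversion table into bijectivity.\<close>

definition signed_perm :: "nat \<Rightarrow> (nat \<Rightarrow> nat) \<Rightarrow> nat set \<Rightarrow> int \<Rightarrow> int" where
  "signed_perm n \<sigma> N x =
     (if x \<in> {- int n..int n} - {0}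
      then sgn x * (if nat \<bar>x\<bar> \<in> N then - 1 else 1) * int (\<sigma> (nat \<bar>x\<bar>)) else x)"

lemma abs_signed_perm:
  assumes "x \<in> {- int n..int n} - {0}"
  shows "\<bar>signed_perm n \<sigma> N x\<bar> = int (\<sigma> (nat \<bar>x\<bar>))"
  using assms by (auto simp: signed_perm_def abs_mult)

lemma signed_perm_in_hyperoctahedral:
  assumes \<sigma>: "\<sigma> permutes {1..n}"
  shows "signed_perm n \<sigma> N \<in> hyperoctahedral n"
proof -
  let ?A = "{- int n..int n} - {0}"
  let ?f = "signed_perm n \<sigma> N"
  have \<sigma>_range: "\<sigma> (nat \<bar>x\<bar>) \<in> {1..n}" if "x \<in> ?A" for x
    using permutes_in_image[OF \<sigma>, of "nat \<bar>x\<bar>"] that by auto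
  have "?f ` ?A \<subseteq> ?A"
  proof
    fix y assume "y \<in> ?f ` ?A"
    then obtain x where "x \<in> ?A" "y = ?f x" by blast
    with abs_signed_perm[of x n \<sigma> N] \<sigma>_range[of x] have "\<bar>y\<bar> \<in> {1..int n}" by simp
    then show "y \<in> ?A" by auto
  qed
  moreover have "inj_on ?f ?A"
  proof (rule inj_onI)
    fix x y assume x: "x \<in> ?A" and y: "y \<in> ?A" and eq: "?f x = ?f y"
    have "\<sigma> (nat \<bar>x\<bar>) = \<sigma> (nat \<bar>y\<bar>)"
      using abs_signed_perm[OF x, of \<sigma> N] abs_signed_perm[OF y, of \<sigma> N] eq by simp
    then have "nat \<bar>x\<bar> = nat \<bar>y\<bar>"
      by (rule injD[OF permutes_inj[OF \<sigma>]])
    then have abs: "\<bar>x\<bar> = \<bar>y\<bar>" by (simp add: eq_nat_nat_iff)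
    \<comment> \<open>The images of \<open>x\<close> and \<open>y\<close> are \<open>sgn x\<close> and \<open>sgn y\<close> times one nonzero factor, which depends on the
      common absolute value only.\<close>
    define c where "c = (if nat \<bar>y\<bar> \<in> N then - 1 else 1) * int (\<sigma> (nat \<bar>y\<bar>))"
    have "c \<noteq> 0" using \<sigma>_range[OF y] by (simp add: c_def)
    moreover have "?f x = sgn x * c" "?f y = sgn y * c"
      using x y by (simp_all only: signed_perm_def c_def abs if_True mult.assoc)
    ultimately have "sgn x = sgn y" using eq by simp
    with abs show "x = y" by (metis mult_sgn_abs)
  qed
  ultimately have "bij_betw ?f ?A ?A"
    by (simp add: bij_betw_def endo_inj_surj)
  then have "?f permutes ?A"
    by (rule bij_imp_permutes) (simp only: signed_perm_def if_False)
  moreover have "?f (- j) = - ?f j" if "j \<in> {1..int n}" for j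
    using that by (auto simp: signed_perm_def)
  ultimately show ?thesis by (simp add: hyperoctahedral_def)
qed

lemma inj_on_signed_perm:
  "inj_on (\<lambda>(\<sigma>, N). signed_perm n \<sigma> N) ({\<sigma>. \<sigma> permutes {1..n}} \<times> Pow {1..n})"
proof (rule inj_onI, clarify)
  fix \<sigma> N \<tau> M
  assume \<sigma>: "\<sigma> permutes {1..n}" and \<tau>: "\<tau> permutes {1..n}"
    and N: "N \<subseteq> {1..n}" and M: "M \<subseteq> {1..n}"
    and eq: "signed_perm n \<sigma> N = signed_perm n \<tau> M"
  have at: "\<sigma> p = \<tau> p \<and> (p \<in> N \<longleftrightarrow> p \<in> M)" if p: "p \<in> {1..n}" for p
  proof -
    have "\<sigma> p \<ge> 1" "\<tau> p \<ge> 1"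
      using permutes_in_image[OF \<sigma>, of p] permutes_in_image[OF \<tau>, of p] p by auto
    with fun_cong[OF eq, of "int p"] p show ?thesis
      by (auto simp: signed_perm_def split: if_splits)
  qed
  have "\<sigma> p = \<tau> p" for p
    using at permutes_not_in[OF \<sigma>] permutes_not_in[OF \<tau>] by (cases "p \<in> {1..n}") auto
  then show "\<sigma> = \<tau> \<and> N = M" using at N M by blast
qed

lemma finite_hyperoctahedral: "finite (hyperoctahedral n)"
  by (rule finite_subset[OF _ finite_permutations[of "{- int n..int n} - {0}"]])
    (auto simp: hyperoctahedral_def)

lemma card_hyperoctahedral_ge: "2 ^ n * fact n \<le> card (hyperoctahedral n)"
proof -
  let ?D = "{\<sigma>. \<sigma> permutes {1..n}} \<times> Pow {1..n}"
  have "card ?D \<le> card (hyperoctahedral n)"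
    by (rule card_inj_on_le[OF inj_on_signed_perm _ finite_hyperoctahedral])
      (auto intro: signed_perm_in_hyperoctahedral)
  moreover have "card ?D = fact n * 2 ^ n"
    by (simp add: card_cartesian_product card_permutations[OF refl] card_Pow)
  ultimately show ?thesis by (simp add: mult.commute)
qed

lemma finite_bounded_vectors: "finite (bounded_vectors n)"
  unfolding bounded_vectors_def by (intro finite_PiE) auto

lemma card_bounded_vectors: "card (bounded_vectors n) = 2 ^ n * fact n"
  by (simp add: bounded_vectors_def card_PiE prod.distrib fact_prod)

lemma bij_betw_inv_table: "bij_betw (inv_table n) (hyperoctahedral n) (bounded_vectors n)"
proof -
  have "inv_table n ` hyperoctahedral n = bounded_vectors n"
  proof (rule card_seteq[OF finite_bounded_vectors])
    show "inv_table n ` hyperoctahedral n \<subseteq> bounded_vectors n"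
      using inv_table_in_bounded_vectors by blast
    show "card (bounded_vectors n) \<le> card (inv_table n ` hyperoctahedral n)"
      using card_hyperoctahedral_ge by (simp add: card_bounded_vectors card_image inj_on_inv_table)
  qed
  with inj_on_inv_table show ?thesis by (simp add: bij_betw_def)
qed

lemma mahonian_B_eq_card_bounded_vectors:
  "mahonian_B n k = card {f \<in> bounded_vectors n. (\<Sum>m=1..n. f m) = k}"
proof -
  have "bij_betw (inv_table n) {\<pi> \<in> hyperoctahedral n. inv_B n \<pi> = k}
      {f \<in> bounded_vectors n. (\<Sum>m=1..n. f m) = k}"
    by (rule bij_betw_Collect[OF bij_betw_inv_table]) (simp add: inv_B_eq_sum_inv_table)
  then show ?thesis
    unfolding mahonian_B_def by (rule bij_betw_same_card)
qed

section \<open>Partitions and their multiplicities\<close>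

lemma length_eq_sum_count_list:
  assumes "finite S" "set ps \<subseteq> S"
  shows "length ps = (\<Sum>j\<in>S. count_list ps j)"
  using sum_count_set[OF assms(2,1)] by simp

lemma sorted_ge_eqI:
  fixes ps qs :: "'a::linorder list"
  assumes "sorted_wrt (\<ge>) ps" "sorted_wrt (\<ge>) qs" "mset ps = mset qs"
  shows "ps = qs"
proof -
  have "rev ps = rev qs"
    using assms properties_for_sort[of "rev qs" "rev qs"] properties_for_sort[of "rev ps" "rev qs"]
    by (simp add: sorted_wrt_rev)
  then show ?thesis by simp
qed

text \<open>A weakly decreasing list is determined by its multiset of entries, and every vector of
  multiplicities is attained by listing that multiset in decreasing order.\<close>

lemma bij_betw_multiplicities:
  "bij_betw (\<lambda>ps. restrict (count_list ps) {1..n}) (restricted_partitions n k)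
     {f \<in> bounded_vectors n. (\<Sum>j=1..n. f j) = k}"
  (is "bij_betw ?F ?P ?V")
proof (rule bij_betwI')
  fix ps qs assume ps: "ps \<in> ?P" and qs: "qs \<in> ?P"
  show "?F ps = ?F qs \<longleftrightarrow> ps = qs"
  proof
    assume eq: "?F ps = ?F qs"
    have "count_list ps j = count_list qs j" for j
    proof (cases "j \<in> {1..n}")
      case True
      then show ?thesis using fun_cong[OF eq, of j] by simp
    next
      case False
      then have "j \<notin> set ps" "j \<notin> set qs"
        using ps qs by (auto simp: restricted_partitions_def)
      then show ?thesis by (simp add: count_list_0_iff)
    qed
    then have "mset ps = mset qs"
      by (intro multiset_eqI) (simp add: count_mset)
    with ps qs show "ps = qs"
      by (intro sorted_ge_eqI) (auto simp: restricted_partitions_def)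
  qed simp
next
  fix ps assume ps: "ps \<in> ?P"
  then have "set ps \<subseteq> {1..n}" by (auto simp: restricted_partitions_def)
  from length_eq_sum_count_list[OF _ this] ps show "?F ps \<in> ?V"
    by (fastforce simp: restricted_partitions_def bounded_vectors_def)
next
  fix f assume f: "f \<in> ?V"
  define M where "M = (\<Sum>j=1..n. replicate_mset (f j) j)"
  define ps where "ps = rev (sorted_list_of_multiset M)"
  have count: "count_list ps j = (if j \<in> {1..n} then f j else 0)" for j
  proof -
    have "count_list ps j = count M j"
      by (simp add: ps_def flip: count_mset)
    also have "\<dots> = (\<Sum>i=1..n. if i = j then f i else 0)"
      by (simp add: M_def count_sum)
    finally show ?thesis by (simp add: sum.delta)
  qed
  then have set: "set ps \<subseteq> {1..n}"
    by (metis count_list_0_iff subsetI)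
  have "length ps = k"
    using f length_eq_sum_count_list[OF _ set] by (simp add: count)
  moreover have "sorted_wrt (\<ge>) ps"
    by (simp add: ps_def sorted_wrt_rev)
  moreover have "count_list ps j \<le> 2 * j - 1" if "j \<in> {1..n}" for j
  proof -
    have "f j < 2 * j" using f that by (auto simp: bounded_vectors_def PiE_iff)
    then show ?thesis using that by (simp add: count)
  qed
  ultimately have "ps \<in> ?P"
    using set by (auto simp: restricted_partitions_def)
  moreover have "f = ?F ps"
    using f count by (auto simp: bounded_vectors_def PiE_iff extensional_def fun_eq_iff)
  ultimately show "\<exists>ps\<in>?P. f = ?F ps" by blast
qed

theorem theorem3p12:
  fixes n k :: nat
  assumes "n \<ge> 1" and "k \<le> n\<^sup>2"
  shows "mahonian_B n k = card (restricted_partitions n k)"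
  using bij_betw_same_card[OF bij_betw_multiplicities]
  by (simp add: mahonian_B_eq_card_bounded_vectors)

end
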